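(* Let $L$ be a spatial frame. The following conditions are equivalent: (1) The frame $N(L)$ of nuclei on $L$ is boolean. (2) $N(L)$ is a complete and atomic boolean algebra. (3) The topological space $(Y_L,\tau)$ is scattered.
   Context: A frame is a complete lattice satisfying $a\wedge\bigvee S=\bigvee\{a\wedge s\mid s\in S\}$. A frame is spatial if it is isomorphic to the frame $\mathcal{O}(S)$ of open sets of some topological space $S$. A frame is boolean if it is a boolean algebra. A nucleus on a frame $L$ is a map $j:L\to L$ with $a\le ja$, $jja\le ja$, and $j(a\wedge b)=ja\wedge jb$ for all $a,b\in L$. $N(L)$ is the set of all nuclei on $L$ ordered by $j\le k$ iff $ja\le ka$ for all $a\in L$; it is a frame. The Esakia space $X_L$ of $L$ is the set of prime (proper) filters of $L$, ordered by inclusion, with the topology $\pi$ whose basis is $\{\varphi(a)\setminus\varphi(b)\mid a,b\in L\}$, where $\varphi(a)=\{x\in X_L\mid a\in x\}$. For $S\subseteq X_L$, ${\downarrow}S=\{x\mid x\le s\text{ for some }s\in S\}$; upsets are sets closed upward under $\le$. A closed subset $F$ of $X_L$ is nuclear if ${\downarrow}(U\cap F)$ is clopen for each clopen $U\subseteq X_L$. $Y_L$ is the set of nuclear points of $X_L$, i.e. of $y\in X_L$ such that $\{y\}$ is nuclear. $\tau$ is the subspace topology on $Y_L$ induced by the topology $\pi_u$ of open upsets of $X_L$ (so $\tau$-open sets are the sets $U\cap Y_L$ with $U$ a $\pi$-open upset of $X_L$). A topological space $S$ is scattered if each nonempty subspace $T$ of $S$ contains an isolated point, i.e. a point $x\in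 T$ with $\{x\}$ open in $T$ (equivalently, each nonempty closed subspace has an isolated point). *)

theory Defs
  imports "HOL-Analysis.Abstract_Topology"
begin

section \<open>Frames\<close>

text \<open>The library class \<^class>\<open>complete_distrib_lattice\<close> is complete distributivity, which is
  strictly stronger than the frame law.\<close>

class frame = complete_lattice +
  assumes inf_Sup_distrib: "inf a (Sup S) = (SUP s\<in>S. inf a s)"

definition frame_iso_opens :: "('a::frame \<Rightarrow> 'b set) \<Rightarrow> 'b topology \<Rightarrow> bool" where
  "frame_iso_opens h T \<longleftrightarrow>
     bij_betw h UNIV {U. openin T U} \<and>
     h top = topspace T \<and>
     (\<forall>a b. h (inf a b) = h a \<inter> h b) \<and>
     (\<forall>S. h (Sup S) = \<Union>(h ` S))"

text \<open>The points of the space range over a type \<open>'b\<close>. As an assumption with \<open>'b\<close> free, this reads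
  ``if there are a type \<open>'b\<close> and a space on a subset of it whose frame of opens is isomorphic to
  the frame \<open>'a\<close>''.\<close>

definition spatial :: "'a::frame itself \<Rightarrow> 'b itself \<Rightarrow> bool" where
  "spatial _ _ \<longleftrightarrow> (\<exists>(T :: 'b topology) (h :: 'a \<Rightarrow> 'b set). frame_iso_opens h T)"

text \<open>The complement (and difference) operations are existentially quantified; everything else is
  the given lattice structure.\<close>

definition boolean :: "'a::bounded_lattice itself \<Rightarrow> bool" where
  "boolean _ \<longleftrightarrow>
     (\<exists>(d :: 'a \<Rightarrow> 'a \<Rightarrow> 'a) c. class.boolean_algebra d c inf (\<le>) (<) sup bot top)"

definition complete_order :: "'a::bounded_lattice itself \<Rightarrow> bool" where
  "complete_order _ \<longleftrightarrow>
     (\<exists>(I :: 'a set \<Rightarrow> 'a) S. class.complete_lattice I S inf (\<le>) (<) sup bot top)"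

definition atom :: "'a::bounded_lattice \<Rightarrow> bool" where
  "atom a \<longleftrightarrow> a \<noteq> bot \<and> (\<forall>b. b \<le> a \<longrightarrow> b = bot \<or> b = a)"

definition atomic :: "'a::bounded_lattice itself \<Rightarrow> bool" where
  "atomic _ \<longleftrightarrow> (\<forall>x::'a. x \<noteq> bot \<longrightarrow> (\<exists>a. atom a \<and> a \<le> x))"

context frame
begin

lemma inf_sup_frame: "inf a (sup b c) = sup (inf a b) (inf a c)"
  using inf_Sup_distrib[of a "{b, c}"] by simp

subclass distrib_lattice
  by standard (rule distrib_imp1, rule inf_sup_frame)

end

section \<open>The frame of nuclei\<close>

definition is_nucleus :: "('a::frame \<Rightarrow> 'a) \<Rightarrow> bool" where
  "is_nucleus j \<longleftrightarrow>
     (\<forall>a. a \<le> j a) \<and> (\<forall>a. j (j a) \<le> j a) \<and> (\<forall>a b. j (inf a b) = inf (j a) (j b))"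

typedef (overloaded) 'a nucleus = "{j :: 'a::frame \<Rightarrow> 'a. is_nucleus j}"
  morphisms nuc Nucleus
  by (rule exI[of _ "\<lambda>a. a"]) (simp add: is_nucleus_def)

setup_lifting type_definition_nucleus

lemma nuc_increasing: "a \<le> nuc j a"
  and nuc_idem: "nuc j (nuc j a) \<le> nuc j a"
  and nuc_inf: "nuc j (inf a b) = inf (nuc j a) (nuc j b)"
  using nuc[of j] by (auto simp: is_nucleus_def)

lemma nuc_mono: "a \<le> b \<Longrightarrow> nuc j a \<le> nuc j b"
  by (metis inf.absorb_iff1 nuc_inf)

lemma is_nucleus_INF: "is_nucleus (\<lambda>a. INF j\<in>J. nuc j a)"
  unfolding is_nucleus_def
proof (intro conjI allI)
  fix a b
  show "a \<le> (INF j\<in>J. nuc j a)"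
    by (simp add: INF_greatest nuc_increasing)
  show "(INF j\<in>J. nuc j (INF j\<in>J. nuc j a)) \<le> (INF j\<in>J. nuc j a)"
  proof (rule INF_mono)
    fix k assume k: "k \<in> J"
    have "nuc k (INF j\<in>J. nuc j a) \<le> nuc k (nuc k a)"
      by (intro nuc_mono INF_lower k)
    also have "\<dots> \<le> nuc k a" by (rule nuc_idem)
    finally show "\<exists>i\<in>J. nuc i (INF j\<in>J. nuc j a) \<le> nuc k a" using k by blast
  qed
  show "(INF j\<in>J. nuc j (inf a b)) = inf (INF j\<in>J. nuc j a) (INF j\<in>J. nuc j b)"
    by (simp add: nuc_inf INF_inf_distrib)
qed

instantiation nucleus :: (frame) complete_lattice
begin

lift_definition less_eq_nucleus :: "'a nucleus \<Rightarrow> 'a nucleus \<Rightarrow> bool"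
  is "\<lambda>j k. \<forall>a. j a \<le> k a" .

definition less_nucleus :: "'a nucleus \<Rightarrow> 'a nucleus \<Rightarrow> bool" where
  "less_nucleus j k \<longleftrightarrow> j \<le> k \<and> \<not> k \<le> j"

definition Inf_nucleus :: "'a nucleus set \<Rightarrow> 'a nucleus" where
  "Inf_nucleus J = Nucleus (\<lambda>a. INF j\<in>J. nuc j a)"

definition Sup_nucleus :: "'a nucleus set \<Rightarrow> 'a nucleus" where
  "Sup_nucleus J = Inf {k. \<forall>j\<in>J. j \<le> k}"

definition inf_nucleus :: "'a nucleus \<Rightarrow> 'a nucleus \<Rightarrow> 'a nucleus" where
  "inf_nucleus j k = Inf {j, k}"

definition sup_nucleus :: "'a nucleus \<Rightarrow> 'a nucleus \<Rightarrow> 'a nucleus" where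
  "sup_nucleus j k = Sup {j, k}"

definition bot_nucleus :: "'a nucleus" where "bot_nucleus = Sup {}"

definition top_nucleus :: "'a nucleus" where "top_nucleus = Inf {}"

lemma nuc_Inf: "nuc (Inf J) a = (INF j\<in>J. nuc j a)"
  by (simp add: Inf_nucleus_def Nucleus_inverse is_nucleus_INF)

lemma nucleus_Inf_lower: "j \<in> J \<Longrightarrow> Inf J \<le> (j :: 'a nucleus)"
  unfolding less_eq_nucleus.rep_eq nuc_Inf by (blast intro: INF_lower)

lemma nucleus_Inf_greatest: "(\<And>j. j \<in> J \<Longrightarrow> k \<le> j) \<Longrightarrow> k \<le> Inf (J :: 'a nucleus set)"
  unfolding less_eq_nucleus.rep_eq nuc_Inf by (blast intro: INF_greatest)

instance
proof
  fix j k l :: "'a nucleus" and J :: "'a nucleus set"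
  show "j < k \<longleftrightarrow> j \<le> k \<and> \<not> k \<le> j" by (rule less_nucleus_def)
  show "j \<le> j" by (simp add: less_eq_nucleus.rep_eq)
  show "j \<le> k \<Longrightarrow> k \<le> l \<Longrightarrow> j \<le> l"
    unfolding less_eq_nucleus.rep_eq by (blast intro: order.trans)
  show "j \<le> k \<Longrightarrow> k \<le> j \<Longrightarrow> j = k"
    unfolding less_eq_nucleus.rep_eq nuc_inject[symmetric] fun_eq_iff by (blast intro: order.antisym)
  show "j \<in> J \<Longrightarrow> Inf J \<le> j" by (rule nucleus_Inf_lower)
  show "(\<And>x. x \<in> J \<Longrightarrow> k \<le> x) \<Longrightarrow> k \<le> Inf J" by (rule nucleus_Inf_greatest)
  show "j \<in> J \<Longrightarrow> j \<le> Sup J"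
    unfolding Sup_nucleus_def by (rule nucleus_Inf_greatest) simp
  show "(\<And>x. x \<in> J \<Longrightarrow> x \<le> k) \<Longrightarrow> Sup J \<le> k"
    unfolding Sup_nucleus_def by (rule nucleus_Inf_lower) simp
  show "inf j k \<le> j" "inf j k \<le> k"
    unfolding inf_nucleus_def by (auto intro: nucleus_Inf_lower)
  show "j \<le> k \<Longrightarrow> j \<le> l \<Longrightarrow> j \<le> inf k l"
    unfolding inf_nucleus_def by (auto intro: nucleus_Inf_greatest)
  show "j \<le> sup j k" "k \<le> sup j k"
    unfolding sup_nucleus_def Sup_nucleus_def by (auto intro: nucleus_Inf_greatest)
  show "k \<le> j \<Longrightarrow> l \<le> j \<Longrightarrow> sup k l \<le> j"
    unfolding sup_nucleus_def Sup_nucleus_def by (auto intro: nucleus_Inf_lower)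
  show "Inf {} = (top :: 'a nucleus)" by (simp add: top_nucleus_def)
  show "Sup {} = (bot :: 'a nucleus)" by (simp add: bot_nucleus_def)
qed

end

lemma nuc_inf_nucleus: "nuc (inf j k) a = inf (nuc j a) (nuc k a)"
  unfolding inf_nucleus_def nuc_Inf by simp

text \<open>The frame law for nuclei: \<open>n\<close> below is the relative pseudocomplement of \<open>j\<close> in \<open>m\<close>.\<close>

lemma nucleus_imp_exists:
  fixes j m :: "'a::frame nucleus"
  obtains n where "\<And>c a. c \<le> nuc n a \<longleftrightarrow> (\<forall>b\<ge>a. inf c (nuc j b) \<le> nuc m b)"
proof -
  define f where "f a = Sup {c. \<forall>b\<ge>a. inf c (nuc j b) \<le> nuc m b}" for a
  have f_iff: "c \<le> f a \<longleftrightarrow> (\<forall>b\<ge>a. inf c (nuc j b) \<le> nuc m b)" for c a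
  proof
    show "c \<le> f a" if "\<forall>b\<ge>a. inf c (nuc j b) \<le> nuc m b"
      unfolding f_def by (rule Sup_upper) (simp add: that)
    show "\<forall>b\<ge>a. inf c (nuc j b) \<le> nuc m b" if "c \<le> f a"
    proof (intro allI impI)
      fix b assume b: "b \<ge> a"
      have "inf c (nuc j b) \<le> inf (nuc j b) (f a)"
        using that by (metis inf.commute inf_mono order.refl)
      also have "\<dots> = (SUP c\<in>{c. \<forall>b\<ge>a. inf c (nuc j b) \<le> nuc m b}. inf (nuc j b) c)"
        unfolding f_def by (rule inf_Sup_distrib)
      also have "\<dots> \<le> nuc m b"
        using b by (intro SUP_least) (simp add: inf.commute[of "nuc j b"])
      finally show "inf c (nuc j b) \<le> nuc m b" .
    qed
  qed
  have fD: "inf (f a) (nuc j b) \<le> nuc m b" if "a \<le> b" for a b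
    using f_iff[of "f a" a] that by blast
  have f_inc: "a \<le> f a" for a
    unfolding f_iff by (intro allI impI inf.coboundedI1) (erule order.trans[OF _ nuc_increasing])
  have f_mono: "f a \<le> f b" if "a \<le> b" for a b
    unfolding f_iff by (intro allI impI fD) (rule order.trans[OF that])
  have f_idem: "f (f a) \<le> f a" for a
    unfolding f_iff
  proof (intro allI impI)
    fix b assume b: "b \<ge> a"
    have "inf (f (f a)) (nuc j b) \<le> inf (inf (f (f b)) (nuc j (f b))) (nuc m (nuc j b))"
      by (intro inf.boundedI inf.coboundedI1[OF f_mono[OF f_mono[OF b]]]
          inf.coboundedI2[OF nuc_mono[OF f_inc]] inf.coboundedI2[OF nuc_increasing])
    also have "\<dots> \<le> inf (nuc m (f b)) (nuc m (nuc j b))"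
      by (intro inf_mono fD) auto
    also have "\<dots> = nuc m (inf (f b) (nuc j b))" by (simp add: nuc_inf)
    also have "\<dots> \<le> nuc m (nuc m b)" by (intro nuc_mono fD) simp
    also have "\<dots> \<le> nuc m b" by (rule nuc_idem)
    finally show "inf (f (f a)) (nuc j b) \<le> nuc m b" .
  qed
  have f_inf: "inf (f a) (f b) \<le> f (inf a b)" for a b
    unfolding f_iff
  proof (intro allI impI)
    fix d assume d: "inf a b \<le> d"
    have "inf (inf (f a) (f b)) (nuc j d)
        \<le> inf (inf (f a) (nuc j (sup a d))) (inf (f b) (nuc j (sup b d)))"
      by (intro inf.boundedI inf.cobounded1 inf.cobounded2
          inf.coboundedI1[OF inf.cobounded1] inf.coboundedI1[OF inf.cobounded2]
          inf.coboundedI2[OF nuc_mono[OF sup_ge2]])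
    also have "\<dots> \<le> inf (nuc m (sup a d)) (nuc m (sup b d))"
      by (intro inf_mono fD) auto
    also have "\<dots> = nuc m (sup (inf a b) d)" by (simp add: nuc_inf sup_inf_distrib2)
    also have "sup (inf a b) d = d" using d by (simp add: sup.absorb2)
    finally show "inf (inf (f a) (f b)) (nuc j d) \<le> nuc m d" .
  qed
  have "is_nucleus f"
    unfolding is_nucleus_def
    by (intro conjI allI f_inc f_inf f_idem order.antisym inf.boundedI f_mono inf.cobounded1 inf.cobounded2)
  then show thesis
    by (intro that[of "Nucleus f"]) (simp add: Nucleus_inverse f_iff)
qed

instance nucleus :: (frame) frame
proof
  fix j :: "'a nucleus" and K :: "'a nucleus set"
  define m where "m = (SUP k\<in>K. inf j k)"
  obtain n where n: "\<And>c a. c \<le> nuc n a \<longleftrightarrow> (\<forall>b\<ge>a. inf c (nuc j b) \<le> nuc m b)"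
    using nucleus_imp_exists[of j m] by metis
  have "k \<le> n" if "k \<in> K" for k
  proof -
    have "inf j k \<le> m" unfolding m_def using that by (rule SUP_upper)
    then have *: "inf (nuc j b) (nuc k b) \<le> nuc m b" for b
      by (simp add: less_eq_nucleus.rep_eq nuc_inf_nucleus)
    have "nuc k a \<le> nuc n a" for a
      unfolding n
    proof (intro allI impI)
      fix b assume "b \<ge> a"
      then have "inf (nuc k a) (nuc j b) \<le> inf (nuc j b) (nuc k b)"
        by (simp add: inf.coboundedI1 nuc_mono)
      with * show "inf (nuc k a) (nuc j b) \<le> nuc m b" by (rule order.trans[rotated])
    qed
    then show ?thesis by (simp add: less_eq_nucleus.rep_eq)
  qed
  then have "Sup K \<le> n" by (rule Sup_least)
  then have "inf (nuc j a) (nuc (Sup K) a) \<le> nuc m a" for a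
    using n[of "nuc (Sup K) a" a] by (simp add: less_eq_nucleus.rep_eq inf.commute)
  then have "inf j (Sup K) \<le> m" by (simp add: less_eq_nucleus.rep_eq nuc_inf_nucleus)
  moreover have "m \<le> inf j (Sup K)"
    unfolding m_def by (auto intro!: SUP_least intro: le_infI2 Sup_upper)
  ultimately show "inf j (Sup K) = (SUP k\<in>K. inf j k)" by (simp add: m_def order.antisym)
qed

section \<open>The Esakia space and its nuclear points\<close>

definition prime_filter :: "'a::frame set \<Rightarrow> bool" where
  "prime_filter x \<longleftrightarrow>
     x \<noteq> {} \<and> x \<noteq> UNIV \<and>
     (\<forall>a b. a \<in> x \<longrightarrow> a \<le> b \<longrightarrow> b \<in> x) \<and>
     (\<forall>a b. a \<in> x \<longrightarrow> b \<in> x \<longrightarrow> inf a b \<in> x) \<and>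
     (\<forall>a b. sup a b \<in> x \<longrightarrow> a \<in> x \<or> b \<in> x)"

definition esakia_points :: "'a::frame set set" where
  "esakia_points = {x. prime_filter x}"

definition phi :: "'a::frame \<Rightarrow> 'a set set" where
  "phi a = {x \<in> esakia_points. a \<in> x}"

definition esakia_basis :: "'a::frame set set set" where
  "esakia_basis = {phi a - phi b | a b. True}"

definition esakia_topology :: "'a::frame set topology" where
  "esakia_topology = topology_generated_by esakia_basis"

lemma bot_notin_prime_filter: "prime_filter x \<Longrightarrow> bot \<notin> x"
  unfolding prime_filter_def by (metis UNIV_eq_I bot_least)

lemma top_in_prime_filter: "prime_filter x \<Longrightarrow> top \<in> x"
  unfolding prime_filter_def by (metis all_not_in_conv top_greatest)

lemma topspace_esakia_topology: "topspace esakia_topology = esakia_points"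
proof -
  have "phi top - phi bot = (esakia_points :: 'a set set)"
    by (auto simp: phi_def esakia_points_def bot_notin_prime_filter top_in_prime_filter)
  then have "esakia_points \<in> (esakia_basis :: 'a set set set)"
    unfolding esakia_basis_def by blast
  then show ?thesis
    by (auto simp: esakia_topology_def esakia_basis_def phi_def)
qed

definition downset :: "'a::frame set set \<Rightarrow> 'a set set" where
  "downset S = {x \<in> esakia_points. \<exists>s\<in>S. x \<subseteq> s}"

definition is_upset :: "'a::frame set set \<Rightarrow> bool" where
  "is_upset S \<longleftrightarrow> S \<subseteq> esakia_points \<and> (\<forall>x\<in>S. \<forall>y\<in>esakia_points. x \<subseteq> y \<longrightarrow> y \<in> S)"

definition clopen :: "'a::frame set set \<Rightarrow> bool" where
  "clopen U \<longleftrightarrow> openin esakia_topology U \<and> closedin esakia_topology U"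

definition nuclear :: "'a::frame set set \<Rightarrow> bool" where
  "nuclear F \<longleftrightarrow>
     closedin esakia_topology F \<and> (\<forall>U. clopen U \<longrightarrow> clopen (downset (U \<inter> F)))"

definition nuclear_points :: "'a::frame set set" where
  "nuclear_points = {y \<in> esakia_points. nuclear {y}}"

definition open_upset_topology :: "'a::frame set topology" where
  "open_upset_topology = topology (\<lambda>U. openin esakia_topology U \<and> is_upset U)"

lemma openin_open_upset_topology:
  "openin open_upset_topology U \<longleftrightarrow> openin esakia_topology U \<and> is_upset U"
proof -
  have "istopology (\<lambda>U :: 'a set set. openin esakia_topology U \<and> is_upset U)"
    unfolding istopology_def
  proof (intro conjI allI impI)
    fix S T :: "'a set set"
    assume "openin esakia_topology S \<and> is_upset S" "openin esakia_topology T \<and> is_upset T"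
    then show "openin esakia_topology (S \<inter> T)" "is_upset (S \<inter> T)"
      by (auto simp: is_upset_def)
  next
    fix K :: "'a set set set"
    assume K: "\<forall>S\<in>K. openin esakia_topology S \<and> is_upset S"
    then show "openin esakia_topology (\<Union>K)" by blast
    show "is_upset (\<Union>K)"
      unfolding is_upset_def
    proof (intro conjI ballI impI)
      show "\<Union>K \<subseteq> esakia_points" using K unfolding is_upset_def by blast
      show "y \<in> \<Union>K" if "x \<in> \<Union>K" "y \<in> esakia_points" "x \<subseteq> y" for x y
        using K that unfolding is_upset_def by blast
    qed
  qed
  then show ?thesis by (simp add: open_upset_topology_def topology_inverse')
qed

definition nuclear_topology :: "'a::frame set topology" where
  "nuclear_topology = subtopology open_upset_topology nuclear_points"

lemma topspace_nuclear_topology: "topspace nuclear_topology = nuclear_points"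
proof -
  have "openin open_upset_topology (esakia_points :: 'a set set)"
    unfolding openin_open_upset_topology is_upset_def
    by (metis openin_topspace subset_refl topspace_esakia_topology)
  then have "(esakia_points :: 'a set set) \<subseteq> topspace open_upset_topology"
    by (rule openin_subset)
  then show ?thesis
    unfolding nuclear_topology_def by (auto simp: nuclear_points_def)
qed

definition scattered :: "'a topology \<Rightarrow> bool" where
  "scattered S \<longleftrightarrow>
     (\<forall>T \<subseteq> topspace S. T \<noteq> {} \<longrightarrow> (\<exists>x\<in>T. openin (subtopology S T) {x}))"

end

theory Submission
  imports Defs
begin

text \<open>The nuclear points of the Esakia space are exactly the completely prime filters
  \<open>{b. \<not> b \<le> p}\<close> for \<open>p\<close> meet-prime, and an open upset is a neighbourhood of a prime filter \<open>y\<close> only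
  if it contains some \<open>\<phi> a\<close> with \<open>a \<in> y\<close>. So \<open>(Y\<^sub>L, \<tau>)\<close> is scattered iff every nonempty set of
  meet-primes has an element isolated by some \<open>a \<in> L\<close>.

  If \<open>N(L)\<close> is boolean and \<open>T\<close> is a nonempty set of meet-primes with infimum \<open>c\<close>, the double
  negation nucleus relative to \<open>c\<close> has a complement \<open>k\<close>. Since it is the largest nucleus fixing \<open>c\<close>,
  \<open>c < k c\<close>; below \<open>k c\<close> the frame of elements above \<open>c\<close> is boolean, so any prime above \<open>c\<close> but not
  above \<open>k c\<close> is isolated in \<open>T\<close>. Conversely, if the space is scattered, then a nucleus is
  determined by the meet-primes it fixes, and every set of meet-primes arises in this way; hence
  \<open>N(L)\<close> is dually isomorphic to a powerset.\<close>

section \<open>Prime filters\<close>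

text \<open>Zorn's lemma on the filters containing \<open>F\<close> and avoiding \<open>I\<close>.
  Distributivity makes a maximal one prime. The last conclusion records maximality: adjoining any
  outside element would make the filter meet \<open>I\<close>.\<close>

lemma maximal_prime_filter:
  fixes F I :: "'a::frame set"
  assumes F: "top \<in> F" "\<And>a b. a \<in> F \<Longrightarrow> a \<le> b \<Longrightarrow> b \<in> F" "\<And>a b. a \<in> F \<Longrightarrow> b \<in> F \<Longrightarrow> inf a b \<in> F"
    and I: "bot \<in> I" "\<And>a b. b \<in> I \<Longrightarrow> a \<le> b \<Longrightarrow> a \<in> I" "\<And>a b. a \<in> I \<Longrightarrow> b \<in> I \<Longrightarrow> sup a b \<in> I"
    and disj: "F \<inter> I = {}"
  obtains x where "prime_filter x" "F \<subseteq> x" "x \<inter> I = {}" "\<And>d. d \<notin> x \<Longrightarrow> \<exists>g\<in>x. inf g d \<in> I"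
proof -
  define \<F> where "\<F> = {G. F \<subseteq> G \<and> G \<inter> I = {} \<and> (\<forall>a b. a \<in> G \<longrightarrow> a \<le> b \<longrightarrow> b \<in> G)
      \<and> (\<forall>a b. a \<in> G \<longrightarrow> b \<in> G \<longrightarrow> inf a b \<in> G)}"
  have "\<exists>x\<in>\<F>. \<forall>X\<in>\<F>. x \<subseteq> X \<longrightarrow> X = x"
  proof (rule subset_Zorn_nonempty)
    show "\<F> \<noteq> {}" using F disj unfolding \<F>_def by blast
    fix \<C> assume ne: "\<C> \<noteq> {}" and chain: "subset.chain \<F> \<C>"
    have sub: "\<C> \<subseteq> \<F>" using chain by (simp add: subset.chain_def)
    have "inf a b \<in> \<Union>\<C>" if ab: "a \<in> \<Union>\<C>" "b \<in> \<Union>\<C>" for a b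
    proof -
      obtain G H where GH: "G \<in> \<C>" "H \<in> \<C>" "a \<in> G" "b \<in> H" using ab by blast
      then have "G \<subseteq> H \<or> H \<subseteq> G" using chain by (auto simp: subset_chain_def)
      then show ?thesis using GH sub unfolding \<F>_def by blast
    qed
    moreover have "F \<subseteq> \<Union>\<C>" "\<Union>\<C> \<inter> I = {}" using ne sub unfolding \<F>_def by blast+
    moreover have "b \<in> \<Union>\<C>" if "a \<in> \<Union>\<C>" "a \<le> b" for a b using that sub unfolding \<F>_def by blast
    ultimately show "\<Union>\<C> \<in> \<F>" unfolding \<F>_def by simp
  qed
  then obtain x where x: "x \<in> \<F>" and max: "\<And>G. G \<in> \<F> \<Longrightarrow> x \<subseteq> G \<Longrightarrow> G = x" by blast
  have xF: "F \<subseteq> x" and xI: "x \<inter> I = {}" and xup: "\<And>a b. a \<in> x \<Longrightarrow> a \<le> b \<Longrightarrow> b \<in> x"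
    and xinf: "\<And>a b. a \<in> x \<Longrightarrow> b \<in> x \<Longrightarrow> inf a b \<in> x"
    using x unfolding \<F>_def by blast+
  have ext: "\<exists>g\<in>x. inf g d \<in> I" if d: "d \<notin> x" for d
  proof (rule ccontr)
    assume no: "\<not> (\<exists>g\<in>x. inf g d \<in> I)"
    \<comment> \<open>\<open>G\<close> is the filter generated by \<open>x\<close> and
      \<open>d\<close>; if it avoided \<open>I\<close>, it would contradict maximality.\<close>
    define G where "G = {b. \<exists>g\<in>x. inf g d \<le> b}"
    have "inf a b \<in> G" if ab: "a \<in> G" "b \<in> G" for a b
    proof -
      obtain g h where gh: "g \<in> x" "h \<in> x" "inf g d \<le> a" "inf h d \<le> b"
        using ab unfolding G_def by blast
      have "inf (inf g h) d \<le> inf (inf g d) (inf h d)" by (simp add: le_infI1 le_infI2)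
      also have "\<dots> \<le> inf a b" using gh by (intro inf_mono)
      finally show ?thesis using xinf gh unfolding G_def by blast
    qed
    moreover have "x \<subseteq> G" unfolding G_def by (auto intro: le_infI1)
    moreover have "G \<inter> I = {}" using no I(2) unfolding G_def by blast
    moreover have "b \<in> G" if "a \<in> G" "a \<le> b" for a b
      using that order.trans[OF _ that(2)] unfolding G_def by blast
    ultimately have "G \<in> \<F>" unfolding \<F>_def using order.trans[OF xF, of G] by simp
    then have "G = x" using max \<open>x \<subseteq> G\<close> by blast
    moreover have "d \<in> G" using xF F(1) unfolding G_def by (auto intro: le_infI2)
    ultimately show False using d by blast
  qed
  have "a \<in> x \<or> b \<in> x" if ab: "sup a b \<in> x" for a b
  proof (rule ccontr)
    assume "\<not> ?thesis"
    then obtain g h where gh: "g \<in> x" "h \<in> x" "inf g a \<in> I" "inf h b \<in> I" using ext by blast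
    have "inf (inf g h) (sup a b) \<le> sup (inf g a) (inf h b)"
      unfolding inf_sup_distrib1 by (intro sup_mono inf_mono) auto
    then have "inf (inf g h) (sup a b) \<in> I" by (rule I(2)[OF I(3)[OF gh(3,4)]])
    then show False using xinf gh ab xI by blast
  qed
  then have "prime_filter x"
    unfolding prime_filter_def using xup xinf subsetD[OF xF F(1)] xI I(1) by auto
  then show thesis using that xF xI ext by blast
qed

text \<open>For the nontrivial direction, a prime filter separates the principal filter of
  \<open>a\<close> from the principal ideal of \<open>b\<close>.\<close>

lemma phi_subset_iff: "phi a \<subseteq> phi (b::'a::frame) \<longleftrightarrow> a \<le> b"
proof
  show "phi a \<subseteq> phi b" if "a \<le> b"
    using that unfolding phi_def esakia_points_def prime_filter_def by blast
  show "a \<le> b" if sub: "phi a \<subseteq> phi b"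
  proof (rule ccontr)
    assume "\<not> a \<le> b"
    then have disj: "{a..} \<inter> {..b} = {}" by auto
    obtain x where "prime_filter x" "{a..} \<subseteq> x" "x \<inter> {..b} = {}"
      by (rule maximal_prime_filter[OF _ _ _ _ _ _ disj]) (auto intro: order.trans)
    then show False using sub unfolding phi_def esakia_points_def by auto
  qed
qed

lemma phi_inf: "phi (inf a b) = phi a \<inter> phi b"
  unfolding phi_def esakia_points_def prime_filter_def
  by auto

lemma phi_sup: "phi (sup a b) = phi a \<union> phi b"
proof -
  have "sup a b \<in> x \<longleftrightarrow> a \<in> x \<or> b \<in> x" if "prime_filter x" for x
    using that sup_ge1[of a b] sup_ge2[of b a] unfolding prime_filter_def by metis
  then show ?thesis by (auto simp: phi_def esakia_points_def)
qed

lemma phi_top: "phi top = esakia_points" and phi_bot: "phi bot = {}"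
  by (auto simp: phi_def esakia_points_def bot_notin_prime_filter top_in_prime_filter)

text \<open>Intersecting two generators \<open>phi c - phi d\<close> gives another one, by meeting
  the first entries and joining the second, so the generating family is a base.\<close>

lemma openin_esakia_basicE:
  assumes "openin esakia_topology U" "y \<in> U"
  obtains c d where "y \<in> phi c - phi d" "phi c - phi d \<subseteq> U"
proof -
  have "generate_topology_on esakia_basis U"
    using assms(1) by (simp add: esakia_topology_def openin_topology_generated_by_iff)
  then have "y \<in> U \<longrightarrow> (\<exists>c d. y \<in> phi c - phi d \<and> phi c - phi d \<subseteq> U)"
  proof (induction rule: generate_topology_on.induct)
    case (Int U V)
    show ?case
    proof
      assume "y \<in> U \<inter> V"
      then obtain c d c' d' where "y \<in> phi c - phi d" "phi c - phi d \<subseteq> U"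
        "y \<in> phi c' - phi d'" "phi c' - phi d' \<subseteq> V" using Int by blast
      then have "y \<in> phi (inf c c') - phi (sup d d') \<and> phi (inf c c') - phi (sup d d') \<subseteq> U \<inter> V"
        unfolding phi_inf phi_sup by blast
      then show "\<exists>c d. y \<in> phi c - phi d \<and> phi c - phi d \<subseteq> U \<inter> V" by blast
    qed
  next
    case (UN K)
    then show ?case by (metis Sup_upper UnionE order.trans)
  next
    case (Basis s)
    then show ?case unfolding esakia_basis_def by blast
  qed simp
  then show thesis using that assms(2) by blast
qed

lemma openin_phi_diff: "openin esakia_topology (phi a - phi b)"
  unfolding esakia_topology_def
  by (rule topology_generated_by_Basis) (auto simp: esakia_basis_def)

lemma openin_phi: "openin esakia_topology (phi a)"
  using openin_phi_diff[of a bot] by (simp add: phi_bot)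

lemma openin_compl_phi: "openin esakia_topology (esakia_points - phi a)"
  using openin_phi_diff[of top a] by (simp add: phi_top)

lemma clopen_compl_phi: "clopen (esakia_points - phi a)"
  unfolding clopen_def
  using openin_compl_phi openin_phi
  by (metis closedin_diff closedin_topspace topspace_esakia_topology)

lemma closedin_esakia_singleton:
  assumes "y \<in> esakia_points"
  shows "closedin esakia_topology {y}"
proof -
  have "closedin esakia_topology (phi a)" for a :: 'a
    using openin_compl_phi[of a]
    by (simp add: closedin_def topspace_esakia_topology phi_def)
  moreover have "{y} = \<Inter> (phi ` y \<union> (\<lambda>a. esakia_points - phi a) ` (- y))"
  proof
    show "{y} \<subseteq> \<Inter> (phi ` y \<union> (\<lambda>a. esakia_points - phi a) ` (- y))"
      using assms by (auto simp: phi_def)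
    show "\<Inter> (phi ` y \<union> (\<lambda>a. esakia_points - phi a) ` (- y)) \<subseteq> {y}"
    proof
      fix x assume x: "x \<in> \<Inter> (phi ` y \<union> (\<lambda>a. esakia_points - phi a) ` (- y))"
      have "x \<in> phi a" if "a \<in> y" for a using x that by blast
      moreover have "x \<in> esakia_points - phi a" if "a \<notin> y" for a using x that by blast
      ultimately have "a \<in> x \<longleftrightarrow> a \<in> y" for a by (cases "a \<in> y") (auto simp: phi_def)
      then show "x \<in> {y}" by auto
    qed
  qed
  \<comment> \<open>Closure under intersections requires a nonempty family.\<close>
  moreover have "phi top \<in> phi ` y"
    using assms by (simp add: esakia_points_def top_in_prime_filter)
  ultimately show ?thesis
    using clopen_compl_phi unfolding clopen_def by (auto intro!: closedin_Inter)
qed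

text \<open>This replaces compactness of the Esakia space: \<open>{a. phi a \<subseteq> U}\<close> is an ideal, and a filter
  containing \<open>y\<close> that is maximal among those avoiding it would lie in the open upset \<open>U\<close>.\<close>

lemma open_upset_contains_phi:
  assumes U: "openin esakia_topology U" "is_upset U" and y: "y \<in> U"
  obtains a where "a \<in> y" "phi a \<subseteq> U"
proof (rule ccontr)
  assume "\<not> thesis"
  then have disj: "y \<inter> {a. phi a \<subseteq> U} = {}" using that by blast
  have py: "prime_filter y" using U y by (auto simp: is_upset_def esakia_points_def)
  obtain x where x: "prime_filter x" "y \<subseteq> x" "x \<inter> {a. phi a \<subseteq> U} = {}"
    and ext: "\<And>d. d \<notin> x \<Longrightarrow> \<exists>g\<in>x. inf g d \<in> {a. phi a \<subseteq> U}"
  proof (rule maximal_prime_filter[OF _ _ _ _ _ _ disj])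
    show "top \<in> y" using py by (rule top_in_prime_filter)
    show "b \<in> y" if "a \<in> y" "a \<le> b" for a b using py that unfolding prime_filter_def by blast
    show "inf a b \<in> y" if "a \<in> y" "b \<in> y" for a b using py that unfolding prime_filter_def by blast
    show "a \<in> {a. phi a \<subseteq> U}" if "b \<in> {a. phi a \<subseteq> U}" "a \<le> b" for a b
      using that phi_subset_iff[of a b] by blast
  qed (auto simp: phi_bot phi_sup)
  have "x \<in> U" using U y x by (auto simp: is_upset_def esakia_points_def)
  then obtain c d where cd: "x \<in> phi c - phi d" "phi c - phi d \<subseteq> U"
    using U(1) openin_esakia_basicE by blast
  then have "c \<in> x" "d \<notin> x" by (auto simp: phi_def)
  then obtain g where g: "g \<in> x" "phi (inf g d) \<subseteq> U" using ext by blast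
  \<comment> \<open>A point of \<open>phi g\<close> and \<open>phi c\<close> lies either in
    \<open>phi d\<close>, hence in \<open>phi (inf g d)\<close>, or in \<open>phi c - phi d\<close>;
    both sets are inside \<open>U\<close>.\<close>
  have "phi (inf g c) \<subseteq> U" using cd g unfolding phi_inf by blast
  moreover have "inf g c \<in> x" using x(1) g \<open>c \<in> x\<close> unfolding prime_filter_def by blast
  ultimately show False using x(3) by blast
qed

section \<open>Nuclear points and meet-primes\<close>

text \<open>These are the points of the frame in the sense of locale theory.\<close>

definition meet_prime :: "'a::frame \<Rightarrow> bool" where
  "meet_prime p \<longleftrightarrow> p \<noteq> top \<and> (\<forall>a b. inf a b \<le> p \<longrightarrow> a \<le> p \<or> b \<le> p)"

definition prime_point :: "'a::frame \<Rightarrow> 'a set" where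
  "prime_point p = {b. \<not> b \<le> p}"

lemma inj_prime_point: "inj prime_point"
  unfolding prime_point_def by (rule injI) (metis (mono_tags) mem_Collect_eq order.antisym order.refl)

lemma prime_filter_prime_point:
  assumes "meet_prime p"
  shows "prime_filter (prime_point p)"
proof -
  have "top \<in> prime_point p" "bot \<notin> prime_point p"
    using assms by (auto simp: prime_point_def meet_prime_def top_unique)
  moreover have "b \<in> prime_point p" if "a \<in> prime_point p" "a \<le> b" for a b
    using that order.trans[of a b p] unfolding prime_point_def by blast
  moreover have "inf a b \<in> prime_point p" if "a \<in> prime_point p" "b \<in> prime_point p" for a b
    using that assms unfolding prime_point_def meet_prime_def by blast
  moreover have "a \<in> prime_point p \<or> b \<in> prime_point p" if "sup a b \<in> prime_point p" for a b
    using that unfolding prime_point_def by simp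
  ultimately show ?thesis unfolding prime_filter_def by auto
qed

text \<open>As \<open>x\<close> is an upset, it contains an element below \<open>p\<close> exactly
  when it contains \<open>p\<close>.\<close>

lemma downset_prime_point:
  assumes "meet_prime p"
  shows "downset {prime_point p} = esakia_points - phi p"
  unfolding downset_def phi_def esakia_points_def prime_filter_def prime_point_def by auto

lemma nuclear_prime_point:
  assumes "meet_prime p"
  shows "prime_point p \<in> nuclear_points"
proof -
  have y: "prime_point p \<in> esakia_points"
    using prime_filter_prime_point[OF assms] by (simp add: esakia_points_def)
  moreover have "clopen (downset (U \<inter> {prime_point p}))" for U
  proof (cases "prime_point p \<in> U")
    case True
    then have "U \<inter> {prime_point p} = {prime_point p}" by blast
    then show ?thesis using downset_prime_point[OF assms] clopen_compl_phi by metis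
  next
    case False
    then show ?thesis by (simp add: downset_def clopen_def)
  qed
  ultimately show ?thesis
    unfolding nuclear_points_def nuclear_def using closedin_esakia_singleton by blast
qed

text \<open>Openness of \<open>downset {y}\<close> suffices. A basic neighbourhood
  \<open>phi c - phi d\<close> of \<open>y\<close> inside it forces \<open>inf c b \<le> d\<close>
  for all \<open>b\<close> outside \<open>y\<close>. The frame law extends this to their join, which
  therefore lies outside \<open>y\<close> too.\<close>

lemma nuclear_point_is_prime_point:
  assumes "y \<in> nuclear_points"
  obtains p where "meet_prime p" "y = prime_point p"
proof -
  have y: "prime_filter y" and nuc: "nuclear {y}"
    using assms by (auto simp: nuclear_points_def esakia_points_def)
  \<comment> \<open>This set is the whole space, taken as the clopen set in the definition of
    nuclearity.\<close>
  have "clopen (esakia_points - phi (bot::'a))" by (rule clopen_compl_phi)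
  then have "clopen (downset ((esakia_points - phi bot) \<inter> {y}))"
    using nuc unfolding nuclear_def by blast
  moreover have "(esakia_points - phi bot) \<inter> {y} = {y}"
    using y by (auto simp: phi_bot esakia_points_def)
  ultimately have "openin esakia_topology (downset {y})" by (simp add: clopen_def)
  moreover have "y \<in> downset {y}" using y by (simp add: downset_def esakia_points_def)
  ultimately obtain c d where cd: "y \<in> phi c - phi d" "phi c - phi d \<subseteq> downset {y}"
    using openin_esakia_basicE by blast
  define p where "p = Sup (- y)"
  have "inf c b \<le> d" if b: "b \<notin> y" for b
  proof -
    have "phi b \<inter> downset {y} = {}" using b by (auto simp: phi_def downset_def)
    then have "phi (inf c b) \<subseteq> phi d" using cd unfolding phi_inf by blast
    then show ?thesis by (simp add: phi_subset_iff)
  qed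
  then have "inf c p \<le> d" unfolding p_def inf_Sup_distrib by (auto intro: SUP_least)
  then have "p \<notin> y" using y cd unfolding prime_filter_def phi_def by blast
  then have "b \<in> y \<longleftrightarrow> \<not> b \<le> p" for b
    using y Sup_upper[of b "- y"] unfolding prime_filter_def p_def by blast
  then have yp: "y = prime_point p" by (auto simp: prime_point_def)
  moreover have "meet_prime p"
    unfolding meet_prime_def
    using y \<open>p \<notin> y\<close> top_in_prime_filter[OF y] unfolding yp prime_filter_def prime_point_def by blast
  ultimately show thesis using that by blast
qed

lemma nuclear_points_eq: "nuclear_points = prime_point ` {p. meet_prime p}"
  using nuclear_prime_point by (auto elim: nuclear_point_is_prime_point)

section \<open>Isolated points of subspaces, expressed through meet-primes\<close>

definition isolated_prime :: "'a::frame \<Rightarrow> 'a set \<Rightarrow> bool" where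
  "isolated_prime p T \<longleftrightarrow> p \<in> T \<and> (\<exists>e. \<not> e \<le> p \<and> (\<forall>q\<in>T. \<not> e \<le> q \<longrightarrow> q = p))"

text \<open>An isolating open upset can be shrunk to some \<open>phi e\<close>, and
  \<open>phi e\<close> contains \<open>prime_point q\<close> exactly when \<open>e\<close> is not
  below \<open>q\<close>.\<close>

lemma isolated_nuclear_point_iff:
  assumes T: "T \<subseteq> {p. meet_prime p}" and p: "p \<in> T"
  shows "openin (subtopology nuclear_topology (prime_point ` T)) {prime_point p} \<longleftrightarrow>
    isolated_prime p T" (is "?L \<longleftrightarrow> ?R")
proof -
  have sub: "prime_point ` T \<subseteq> nuclear_points" using T nuclear_points_eq by blast
  have esakia: "prime_point q \<in> esakia_points" if "q \<in> T" for q
    using that T prime_filter_prime_point by (auto simp: esakia_points_def)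
  have L: "?L \<longleftrightarrow> (\<exists>U. openin esakia_topology U \<and> is_upset U \<and>
      {prime_point p} = U \<inter> prime_point ` T)"
    using sub by (auto simp: nuclear_topology_def subtopology_subtopology openin_subtopology
      openin_open_upset_topology inf.absorb2)
  show ?thesis
  proof
    assume ?L
    then obtain U where U: "openin esakia_topology U" "is_upset U"
      and eq: "{prime_point p} = U \<inter> prime_point ` T" using L by blast
    then obtain e where e: "e \<in> prime_point p" "phi e \<subseteq> U"
      using open_upset_contains_phi[OF U, of "prime_point p"] by blast
    have "q = p" if "q \<in> T" "\<not> e \<le> q" for q
    proof -
      have "prime_point q \<in> phi e" using that esakia by (auto simp: phi_def prime_point_def)
      then have "prime_point q = prime_point p" using e eq that by blast
      then show ?thesis by (rule injD[OF inj_prime_point])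
    qed
    then show ?R using e(1) p unfolding isolated_prime_def prime_point_def by blast
  next
    assume ?R
    then obtain e where e: "\<not> e \<le> p" "\<And>q. q \<in> T \<Longrightarrow> \<not> e \<le> q \<Longrightarrow> q = p"
      unfolding isolated_prime_def by blast
    have "is_upset (phi e)" by (auto simp: is_upset_def phi_def)
    moreover have "prime_point q \<in> phi e \<longleftrightarrow> q = p" if "q \<in> T" for q
      using e that esakia[OF that] unfolding phi_def prime_point_def by blast
    then have "{prime_point p} = phi e \<inter> prime_point ` T" using p by blast
    ultimately show ?L unfolding L using openin_phi[of e] by blast
  qed
qed

lemma scattered_nuclear_topology_iff:
  "scattered (nuclear_topology :: 'a::frame set topology) \<longleftrightarrow>
    (\<forall>T \<subseteq> {p::'a. meet_prime p}. T \<noteq> {} \<longrightarrow> (\<exists>p. isolated_prime p T))"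
proof -
  have "(\<exists>x\<in>prime_point ` T. openin (subtopology nuclear_topology (prime_point ` T)) {x}) \<longleftrightarrow>
      (\<exists>p. isolated_prime p T)" if "T \<subseteq> {p::'a. meet_prime p}" for T
    using isolated_nuclear_point_iff[OF that] unfolding bex_simps isolated_prime_def by blast
  then show ?thesis
    unfolding scattered_def topspace_nuclear_topology nuclear_points_eq all_subset_image image_is_empty
    by simp
qed

text \<open>A point \<open>x\<close> in \<open>h a\<close> but not in \<open>h b\<close> yields
  \<open>p\<close>, the element whose open set is the complement of the closure of
  \<open>x\<close>.\<close>

lemma spatial_separation:
  assumes "spatial TYPE('a::frame) TYPE('b)" and ab: "\<not> (a::'a) \<le> b"
  shows "\<exists>p. meet_prime p \<and> b \<le> p \<and> \<not> a \<le> p"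
proof -
  obtain T :: "'b topology" and h :: "'a \<Rightarrow> 'b set" where h: "frame_iso_opens h T"
    using assms(1) unfolding spatial_def by blast
  have inj: "inj h" and top: "h top = topspace T" and hinf: "\<And>a b. h (inf a b) = h a \<inter> h b"
    and hSup: "\<And>S. h (Sup S) = \<Union> (h ` S)" and surj: "range h = {U. openin T U}"
    using h by (simp_all add: frame_iso_opens_def bij_betw_def)
  have op: "openin T (h a)" for a using surj by blast
  have le: "c \<le> d \<longleftrightarrow> h c \<subseteq> h d" for c d
    using hinf[of c d] inj by (metis inf.absorb_iff1 inj_eq)
  obtain x where x: "x \<in> h a" "x \<notin> h b" using ab le by blast
  define p where "p = Sup {c. x \<notin> h c}"
  have xp: "x \<notin> h p" unfolding p_def hSup by blast
  have p: "c \<le> p \<longleftrightarrow> x \<notin> h c" for c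
    using xp le[of c p] Sup_upper[of c "{c. x \<notin> h c}"] unfolding p_def by blast
  have "x \<in> h top" using x(1) openin_subset[OF op[of a]] top by blast
  then have "meet_prime p" unfolding meet_prime_def p using hinf xp by auto
  then show ?thesis using p x by blast
qed

section \<open>Nuclei\<close>

definition imp :: "'a::frame \<Rightarrow> 'a \<Rightarrow> 'a" where
  "imp a b = Sup {z. inf z a \<le> b}"

lemma le_imp_iff: "z \<le> imp a b \<longleftrightarrow> inf z a \<le> b"
proof
  have "inf a (imp a b) \<le> b"
    unfolding imp_def inf_Sup_distrib by (rule SUP_least) (simp add: inf.commute)
  then show "inf z a \<le> b" if "z \<le> imp a b"
    using that by (metis inf.commute inf_mono order.refl order.trans)
qed (auto simp: imp_def intro: Sup_upper)

lemma imp_inf_le: "inf (imp a b) a \<le> b"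
  using le_imp_iff[of "imp a b" a b] by simp

lemma is_nucleus_double_neg: "is_nucleus (\<lambda>a. imp (imp a c) c)"
proof -
  have anti: "imp b c \<le> imp a c" if "a \<le> b" for a b
    unfolding le_imp_iff using that imp_inf_le by (metis inf_mono order.refl order.trans)
  have inc: "a \<le> imp (imp a c) c" for a
    unfolding le_imp_iff by (metis imp_inf_le inf.commute)
  have meet: "inf (imp (imp a c) c) (imp (imp b c) c) \<le> imp (imp (inf a b) c) c" for a b
  proof -
    let ?n = "imp (inf a b) c" and ?A = "imp (imp a c) c" and ?B = "imp (imp b c) c"
    have "inf (inf ?n a) b \<le> c" using imp_inf_le by (metis inf.assoc)
    then have "inf ?n a \<le> imp b c" by (simp add: le_imp_iff)
    then have "inf ?B (inf ?n a) \<le> c"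
      by (meson imp_inf_le inf_mono order.refl order.trans)
    then have "inf ?B ?n \<le> imp a c" by (simp add: le_imp_iff inf.assoc)
    then have "inf ?A (inf ?B ?n) \<le> c"
      by (meson imp_inf_le inf_mono order.refl order.trans)
    then show ?thesis by (simp add: le_imp_iff inf.assoc)
  qed
  show ?thesis
    unfolding is_nucleus_def
    by (intro conjI allI inc anti meet order.antisym inf.boundedI inf.cobounded1 inf.cobounded2)
qed

text \<open>Double negation relative to \<open>c\<close> is the largest nucleus fixing
  \<open>c\<close>: meeting \<open>nuc k a\<close> with \<open>imp a c\<close> stays below
  \<open>nuc k (inf a (imp a c))\<close>, hence below \<open>nuc k c\<close>.\<close>

lemma nucleus_le_double_neg:
  assumes "nuc k c \<le> c"
  shows "nuc k a \<le> imp (imp a c) c"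
  unfolding le_imp_iff
proof -
  have "inf (nuc k a) (imp a c) \<le> inf (nuc k a) (nuc k (imp a c))"
    by (intro inf_mono nuc_increasing order.refl)
  also have "\<dots> \<le> nuc k c"
    unfolding nuc_inf[symmetric] by (intro nuc_mono) (metis imp_inf_le inf.commute)
  finally show "inf (nuc k a) (imp a c) \<le> c" using assms by simp
qed

lemma nuc_bot: "nuc bot (a::'a::frame) = a"
proof -
  have "is_nucleus (\<lambda>a::'a. a)" by (simp add: is_nucleus_def)
  then have "nuc (Nucleus (\<lambda>a::'a. a)) a = a" by (simp add: Nucleus_inverse)
  moreover have "bot \<le> Nucleus (\<lambda>a::'a. a)" by simp
  ultimately show ?thesis
    unfolding less_eq_nucleus.rep_eq by (metis nuc_increasing order.antisym)
qed

lemma nuc_top: "nuc top a = top"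
  by (simp add: nuc_Inf flip: Inf_empty)

lemma boolean_complement:
  fixes x :: "'a::bounded_lattice"
  assumes "boolean TYPE('a)"
  obtains y where "inf x y = bot" "sup x y = top"
proof -
  obtain d and c :: "'a \<Rightarrow> 'a" where "class.boolean_algebra d c inf (\<le>) (<) sup bot top"
    using assms unfolding boolean_def by blast
  then interpret boolean_algebra d c inf "(\<le>)" "(<)" sup bot top .
  show thesis using that inf_compl_bot sup_compl_top by blast
qed

section \<open>Passing between nuclei and sets of meet-primes\<close>

definition nuc_of_primes :: "'a::frame set \<Rightarrow> 'a nucleus" where
  "nuc_of_primes T = Nucleus (\<lambda>a. Inf {p\<in>T. a \<le> p})"

definition fixed_primes :: "'a::frame nucleus \<Rightarrow> 'a set" where
  "fixed_primes j = {p. meet_prime p \<and> nuc j p = p}"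

text \<open>Primality enters through binary meets: a prime is above \<open>inf a b\<close> exactly
  when it is above \<open>a\<close> or above \<open>b\<close>.\<close>

lemma nuc_nuc_of_primes:
  assumes T: "T \<subseteq> {p. meet_prime p}"
  shows "nuc (nuc_of_primes T) a = Inf {p\<in>T. a \<le> p}"
proof -
  have "is_nucleus (\<lambda>a. Inf {p\<in>T. a \<le> p})"
    unfolding is_nucleus_def
  proof (intro conjI allI)
    fix a b :: 'a
    show "a \<le> Inf {p \<in> T. a \<le> p}" by (auto intro: Inf_greatest)
    show "Inf {p \<in> T. Inf {p \<in> T. a \<le> p} \<le> p} \<le> Inf {p \<in> T. a \<le> p}"
      by (rule Inf_superset_mono) (auto intro: Inf_lower)
    have "{p \<in> T. inf a b \<le> p} = {p \<in> T. a \<le> p} \<union> {p \<in> T. b \<le> p}"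
      using T by (auto simp: meet_prime_def intro: le_infI1 le_infI2)
    then show "Inf {p \<in> T. inf a b \<le> p} = inf (Inf {p \<in> T. a \<le> p}) (Inf {p \<in> T. b \<le> p})"
      by (simp add: Inf_union_distrib)
  qed
  then show ?thesis by (simp add: nuc_of_primes_def Nucleus_inverse)
qed

lemma nuc_of_primes_antimono:
  "T \<subseteq> T' \<Longrightarrow> T' \<subseteq> {p. meet_prime p} \<Longrightarrow> nuc_of_primes T' \<le> nuc_of_primes T"
  unfolding less_eq_nucleus.rep_eq by (auto simp: nuc_nuc_of_primes intro!: Inf_superset_mono)

lemma nuc_of_primes_Un:
  assumes "T \<subseteq> {p. meet_prime p}" "T' \<subseteq> {p. meet_prime p}"
  shows "inf (nuc_of_primes T) (nuc_of_primes T') = nuc_of_primes (T \<union> T')"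
proof -
  have "{p \<in> T \<union> T'. a \<le> p} = {p \<in> T. a \<le> p} \<union> {p \<in> T'. a \<le> p}" for a by blast
  then have "nuc (inf (nuc_of_primes T) (nuc_of_primes T')) = nuc (nuc_of_primes (T \<union> T'))"
    using assms by (auto simp: nuc_inf_nucleus nuc_nuc_of_primes Inf_union_distrib)
  then show ?thesis by (simp add: nuc_inject)
qed

lemma fixed_primes_antimono:
  assumes "j \<le> k" shows "fixed_primes k \<subseteq> fixed_primes j"
  unfolding fixed_primes_def
  using assms nuc_increasing unfolding less_eq_nucleus.rep_eq
  by (metis (mono_tags, lifting) Collect_mono order.antisym)

lemma fixed_primes_subset: "fixed_primes j \<subseteq> {p. meet_prime p}"
  by (auto simp: fixed_primes_def)

lemma fixed_primes_bot: "fixed_primes bot = {p. meet_prime p}"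
  by (simp add: fixed_primes_def nuc_bot)

section \<open>Boolean frames of nuclei and scatteredness\<close>

context
  assumes separation: "\<And>a b :: 'a::frame. \<not> a \<le> b \<Longrightarrow> \<exists>p. meet_prime p \<and> b \<le> p \<and> \<not> a \<le> p"
begin

lemma boolean_nuclei_isolated_prime:
  assumes bool: "boolean TYPE('a nucleus)" and T: "T \<subseteq> {p::'a. meet_prime p}" and ne: "T \<noteq> {}"
  shows "\<exists>p. isolated_prime p T"
proof -
  define c where "c = Inf T"
  define w where "w = Nucleus (\<lambda>a. imp (imp a c) c)"
  have w: "nuc w a = imp (imp a c) c" for a
    by (simp add: w_def Nucleus_inverse is_nucleus_double_neg)
  obtain q where "q \<in> T" using ne by blast
  then have "c \<noteq> top" using T unfolding c_def meet_prime_def by (auto simp: Inf_top_conv)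
  have "nuc w c = c"
    unfolding w by (rule order.antisym) (metis imp_inf_le inf.absorb1 inf_le2 le_imp_iff top_greatest,
      metis imp_inf_le inf.commute le_imp_iff)
  obtain k where k: "inf w k = bot" "sup w k = top" using boolean_complement[OF bool] .
  define d where "d = nuc k c"
  \<comment> \<open>Otherwise \<open>k\<close> fixes \<open>c\<close>, so \<open>k \<le> w\<close>
    and \<open>w = sup w k = top\<close>, although \<open>w\<close> fixes
    \<open>c \<noteq> top\<close>.\<close>
  have "\<not> d \<le> c"
  proof
    assume "d \<le> c"
    then have "k \<le> w"
      unfolding less_eq_nucleus.rep_eq w d_def using nucleus_le_double_neg by blast
    then have "w = top" using k by (simp add: sup.absorb1)
    then show False using \<open>nuc w c = c\<close> \<open>c \<noteq> top\<close> by (simp add: nuc_top)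
  qed
  then obtain p where p: "meet_prime p" "c \<le> p" "\<not> d \<le> p" using separation by blast
  \<comment> \<open>If \<open>imp q c \<le> q\<close>, then \<open>imp q c \<le> c\<close> and
    \<open>nuc w q = top\<close>. Since \<open>inf w k = bot\<close>, \<open>k\<close> must fix
    \<open>q\<close>, which gives \<open>d = nuc k c \<le> q\<close>.\<close>
  have neg: "\<not> imp q c \<le> q" if q: "meet_prime q" "c \<le> q" "\<not> d \<le> q" for q
  proof
    assume "imp q c \<le> q"
    then have "imp q c \<le> c" using imp_inf_le[of q c] by (simp add: inf.absorb1)
    then have "nuc w q = top"
      unfolding w by (intro order.antisym top_greatest) (simp add: le_imp_iff)
    moreover have "inf (nuc w q) (nuc k q) = q" by (metis k(1) nuc_inf_nucleus nuc_bot)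
    ultimately have "nuc k q = q" by simp
    then show False using q nuc_mono[of c q k] by (simp add: d_def)
  qed
  \<comment> \<open>For a prime \<open>q \<ge> c\<close> not above \<open>e\<close>, the factor
    \<open>imp p c\<close> forces \<open>p \<le> q\<close>; the factor \<open>d\<close> makes
    \<open>neg\<close> available for \<open>q\<close>, which gives \<open>q \<le> p\<close>.\<close>
  define e where "e = inf (imp p c) d"
  have e: "\<not> e \<le> p" using neg[OF p] p unfolding e_def meet_prime_def by blast
  have uniq: "q = p" if q: "q \<in> T" "\<not> e \<le> q" for q
  proof (rule order.antisym)
    have q': "meet_prime q" "c \<le> q" using q T by (auto simp: c_def Inf_lower)
    have n: "\<not> imp p c \<le> q" "\<not> d \<le> q" using q unfolding e_def by (auto intro: le_infI1 le_infI2)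
    have "inf (imp p c) p \<le> q" using imp_inf_le q'(2) by (rule order.trans)
    then show pq: "p \<le> q" using n q' unfolding meet_prime_def by blast
    have "inf (imp q c) q \<le> p" using imp_inf_le p(2) by (rule order.trans)
    then show "q \<le> p" using neg[OF q' n(2)] pq p(1) unfolding meet_prime_def by (meson order.trans)
  qed
  \<comment> \<open>Separation gave \<open>p\<close> without membership in \<open>T\<close>. As
    \<open>c\<close> is the infimum of \<open>T\<close>, some element of \<open>T\<close> is not
    above \<open>e\<close>, and by uniqueness it is \<open>p\<close>.\<close>
  have "\<not> e \<le> c" using e p(2) by (meson order.trans)
  then obtain q where "q \<in> T" "\<not> e \<le> q" unfolding c_def by (meson Inf_greatest)
  then have "p \<in> T" using uniq by blast
  then show ?thesis unfolding isolated_prime_def using e uniq by blast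
qed

lemma nuc_of_all_primes: "nuc_of_primes {p::'a. meet_prime p} = bot"
proof -
  have "Inf {p \<in> {p. meet_prime p}. a \<le> p} \<le> a" for a :: 'a
    using separation[of _ a] by (metis (mono_tags, lifting) Inf_lower mem_Collect_eq)
  then have "nuc_of_primes {p::'a. meet_prime p} \<le> bot"
    unfolding less_eq_nucleus.rep_eq by (simp add: nuc_nuc_of_primes nuc_bot)
  then show ?thesis by (simp add: bot_unique)
qed

section \<open>From isolated primes to the dual isomorphism with a powerset\<close>

context
  assumes isolated: "\<And>T. T \<subseteq> {p::'a. meet_prime p} \<Longrightarrow> T \<noteq> {} \<Longrightarrow> \<exists>p. isolated_prime p T"
begin

text \<open>If the meet \<open>b\<close> of the fixed primes above \<open>a\<close> were not below
  \<open>nuc j a\<close>, an isolated member of the primes above \<open>nuc j a\<close> but not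
  above \<open>b\<close> would turn out to be fixed by \<open>j\<close>, hence above
  \<open>b\<close>.\<close>

lemma nuc_of_fixed_primes: "nuc_of_primes (fixed_primes j) = (j :: 'a nucleus)"
proof -
  have "nuc (nuc_of_primes (fixed_primes j)) a = nuc j a" for a
    unfolding nuc_nuc_of_primes[OF fixed_primes_subset]
  proof (rule order.antisym)
    show "nuc j a \<le> Inf {p \<in> fixed_primes j. a \<le> p}"
      by (rule Inf_greatest) (auto simp: fixed_primes_def dest: nuc_mono[of a _ j])
    define b where "b = Inf {p \<in> fixed_primes j. a \<le> p}"
    show "b \<le> nuc j a"
    proof (rule ccontr)
      assume "\<not> b \<le> nuc j a"
      then have "{p. meet_prime p \<and> nuc j a \<le> p \<and> \<not> b \<le> p} \<noteq> {}" using separation by blast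
      then obtain p where "isolated_prime p {p. meet_prime p \<and> nuc j a \<le> p \<and> \<not> b \<le> p}"
        using isolated[of "{p. meet_prime p \<and> nuc j a \<le> p \<and> \<not> b \<le> p}"] by blast
      then obtain e where p: "meet_prime p" "nuc j a \<le> p" "\<not> b \<le> p" and e: "\<not> e \<le> p"
        and uniq: "\<And>q. meet_prime q \<Longrightarrow> nuc j a \<le> q \<Longrightarrow> \<not> b \<le> q \<Longrightarrow> \<not> e \<le> q \<Longrightarrow> q = p"
        unfolding isolated_prime_def by blast
      \<comment> \<open>The only prime above \<open>nuc j a\<close> and above neither
        \<open>e\<close> nor \<open>b\<close> is \<open>p\<close>, so every prime above
        \<open>nuc j a\<close> is above this meet. Applying \<open>j\<close> and primality of
        \<open>p\<close> then yields \<open>nuc j p \<le> p\<close>.\<close>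
      have "inf (inf e b) p \<le> nuc j a"
      proof (rule ccontr)
        assume "\<not> ?thesis"
        then obtain q where "meet_prime q" "nuc j a \<le> q" "\<not> inf (inf e b) p \<le> q"
          using separation by blast
        moreover from this have "q = p" using uniq by (meson le_infI1 le_infI2)
        ultimately show False by simp
      qed
      then have "nuc j (inf (inf e b) p) \<le> nuc j a"
        using nuc_mono nuc_idem by (meson order.trans)
      then have "inf (inf e b) (nuc j p) \<le> p"
        using p(2) nuc_increasing[of "inf e b" j] unfolding nuc_inf[of j "inf e b"]
        by (meson inf_mono order.refl order.trans)
      then have "nuc j p \<le> p" using p e unfolding meet_prime_def by blast
      then have "p \<in> fixed_primes j"
        using p nuc_increasing by (auto simp: fixed_primes_def intro: order.antisym)
      moreover have "a \<le> p" using p nuc_increasing by (meson order.trans)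
      ultimately have "b \<le> p" unfolding b_def by (auto intro: Inf_lower)
      then show False using p by blast
    qed
  qed
  then show ?thesis by (metis ext nuc_inject)
qed

text \<open>A fixed prime \<open>p\<close> is isolated among the primes above it by some
  \<open>e\<close>. Were \<open>p\<close> not in \<open>T\<close>, every member of \<open>T\<close>
  above \<open>p\<close> would be above \<open>e\<close>, and so would their meet
  \<open>p\<close>.\<close>

lemma fixed_primes_nuc_of_primes:
  assumes T: "T \<subseteq> {p::'a. meet_prime p}"
  shows "fixed_primes (nuc_of_primes T) = T"
proof
  show "T \<subseteq> fixed_primes (nuc_of_primes T)"
    using T by (auto simp: fixed_primes_def nuc_nuc_of_primes
        intro!: order.antisym Inf_lower Inf_greatest)
  show "fixed_primes (nuc_of_primes T) \<subseteq> T"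
  proof
    fix p assume "p \<in> fixed_primes (nuc_of_primes T)"
    then have p: "meet_prime p" "Inf {q \<in> T. p \<le> q} = p"
      using T by (auto simp: fixed_primes_def nuc_nuc_of_primes)
    then obtain r where "isolated_prime r {q. meet_prime q \<and> p \<le> q}"
      using isolated[of "{q. meet_prime q \<and> p \<le> q}"] by blast
    then obtain e where r: "p \<le> r" "\<not> e \<le> r"
      and e: "\<And>q. meet_prime q \<Longrightarrow> p \<le> q \<Longrightarrow> \<not> e \<le> q \<Longrightarrow> q = r"
      unfolding isolated_prime_def by blast
    have np: "\<not> e \<le> p" using r by (meson order.trans)
    \<comment> \<open>If \<open>e\<close> were below \<open>p\<close>, it would be below
      \<open>r \<ge> p\<close>; so \<open>p\<close> is itself a prime not above
      \<open>e\<close>.\<close>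
    then have "r = p" using e p by blast
    show "p \<in> T"
    proof (rule ccontr)
      assume "p \<notin> T"
      then have "e \<le> q" if "q \<in> T" "p \<le> q" for q using that e T \<open>r = p\<close> by blast
      then have "e \<le> Inf {q \<in> T. p \<le> q}" by (auto intro: Inf_greatest)
      then show False using np p by simp
    qed
  qed
qed

text \<open>Complements come from complementary sets of meet-primes; the correspondence reverses
  order, so the union gives the meet of nuclei.\<close>

lemma boolean_nuclei: "boolean TYPE('a nucleus)"
proof -
  define c where "c j = nuc_of_primes ({p. meet_prime p} - fixed_primes j)" for j :: "'a nucleus"
  have inf: "inf j (c j) = bot" for j
  proof -
    have "inf j (c j) = inf (nuc_of_primes (fixed_primes j)) (c j)" by (simp add: nuc_of_fixed_primes)
    also have "\<dots> = nuc_of_primes (fixed_primes j \<union> ({p. meet_prime p} - fixed_primes j))"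
      unfolding c_def by (intro nuc_of_primes_Un) (auto simp: fixed_primes_def)
    also have "fixed_primes j \<union> ({p. meet_prime p} - fixed_primes j) = {p. meet_prime p}"
      by (auto simp: fixed_primes_def)
    finally show ?thesis by (simp add: nuc_of_all_primes)
  qed
  have sup: "sup j (c j) = top" for j
  proof -
    have "fixed_primes (sup j (c j)) \<subseteq> fixed_primes j \<inter> fixed_primes (c j)"
      by (simp add: fixed_primes_antimono)
    also have "\<dots> = {}" unfolding c_def by (subst fixed_primes_nuc_of_primes) auto
    finally have "sup j (c j) = nuc_of_primes {}" by (metis nuc_of_fixed_primes subset_empty)
    moreover have "top = nuc_of_primes ({} :: 'a set)"
      by (metis nuc_of_fixed_primes nuc_of_primes_antimono empty_subsetI fixed_primes_subset top.extremum_uniqueI)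
    ultimately show ?thesis by simp
  qed
  have "class.boolean_algebra (\<lambda>j k. inf j (c k)) c inf (\<le>) (<) sup bot top"
    by unfold_locales (use inf sup in \<open>simp_all add: sup_inf_distrib1\<close>)
  then show ?thesis unfolding boolean_def by blast
qed

text \<open>By order reversal, atoms correspond to sets omitting exactly one meet-prime; a prime not
  fixed by \<open>x\<close> supplies an atom below \<open>x\<close>.\<close>

lemma atomic_nuclei: "atomic TYPE('a nucleus)"
  unfolding atomic_def
proof (intro allI impI)
  fix x :: "'a nucleus" assume "x \<noteq> bot"
  then have "fixed_primes x \<noteq> {p. meet_prime p}" using nuc_of_fixed_primes nuc_of_all_primes by metis
  then obtain p where p: "meet_prime p" "p \<notin> fixed_primes x" using fixed_primes_subset by blast
  define a where "a = nuc_of_primes ({p. meet_prime p} - {p})"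
  have fa: "fixed_primes a = {p. meet_prime p} - {p}"
    unfolding a_def by (rule fixed_primes_nuc_of_primes) blast
  have "a \<noteq> bot" using fa p fixed_primes_bot by auto
  moreover have "b = bot \<or> b = a" if "b \<le> a" for b
  proof -
    have "fixed_primes b = {p. meet_prime p} \<or> fixed_primes b = {p. meet_prime p} - {p}"
      using fixed_primes_antimono[OF that] fixed_primes_subset[of b] fa by blast
    then show ?thesis using nuc_of_fixed_primes nuc_of_all_primes fa by metis
  qed
  moreover have "a \<le> x"
  proof -
    have "fixed_primes x \<subseteq> {p. meet_prime p} - {p}" using p fixed_primes_subset by blast
    then have "a \<le> nuc_of_primes (fixed_primes x)" unfolding a_def by (rule nuc_of_primes_antimono) blast
    then show ?thesis by (simp add: nuc_of_fixed_primes)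
  qed
  ultimately show "\<exists>a. atom a \<and> a \<le> x" unfolding atom_def by blast
qed

end

end

lemma complete_order_complete_lattice: "complete_order TYPE('a::complete_lattice)"
  unfolding complete_order_def using complete_lattice_class.complete_lattice_axioms by blast

theorem theorem7p14:
  assumes "spatial TYPE('a::frame) TYPE('b)"
  shows "(boolean TYPE('a nucleus) \<longleftrightarrow>
            complete_order TYPE('a nucleus) \<and> atomic TYPE('a nucleus) \<and> boolean TYPE('a nucleus))
       \<and> (complete_order TYPE('a nucleus) \<and> atomic TYPE('a nucleus) \<and> boolean TYPE('a nucleus) \<longleftrightarrow>
            scattered (nuclear_topology :: 'a set topology))"
proof -
  note sep = spatial_separation[OF assms]
  have "scattered (nuclear_topology :: 'a set topology)" if "boolean TYPE('a nucleus)"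
    using boolean_nuclei_isolated_prime[OF sep that] by (simp add: scattered_nuclear_topology_iff)
  moreover have "boolean TYPE('a nucleus) \<and> atomic TYPE('a nucleus)"
    if "scattered (nuclear_topology :: 'a set topology)"
    using that boolean_nuclei[OF sep] atomic_nuclei[OF sep]
    unfolding scattered_nuclear_topology_iff by blast
  \<comment> \<open>Completeness holds for every frame of nuclei, and atomicity reaches the boolean
    case by way of scatteredness.\<close>
  ultimately show ?thesis using complete_order_complete_lattice by blast
qed

end
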